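(* Let $R=\mathbb F_{q_1}\times\mathbb F_{q_2}\times\mathbb F_{q_3}\times\mathbb F_{q_4}$ be a product of four finite fields of orders $q_1,\dots,q_4$. Then $$\omega(\mathcal D(R))=\max\Bigl(\max_{1\le k\le 4}\operatorname{Star}(k),\ \max_{1\le i\le 4}\operatorname{Tri}(i)\Bigr),$$ where $$\operatorname{Star}(k)=(q_k-1)\Bigl(1+\sum_{j\in[4]\setminus\{k\}}(q_j-1)\Bigr)+3$$ and $$\operatorname{Tri}(i)=\sum_{\{x,y\}\subset\{a,b,c\}}(q_x-1)(q_y-1)+4,\qquad \{a,b,c\}=[4]\setminus\{i\},$$ the last sum being over the three $2$-element subsets $\{x,y\}$ of $\{a,b,c\}$.
   Context: $[4]=\{1,2,3,4\}$. $Z(R)$ is the set of zero-divisors of $R$ and $Z(R)^*=Z(R)\setminus\{0\}$. $\Gamma(R)$ is the simple graph with vertex set $Z(R)^*$, with distinct $x,y$ adjacent iff $xy=0$. $W\Gamma(R)$ is the simple graph with vertex set $Z(R)^*$, with distinct $x,y$ adjacent iff there exist nonzero $r\in\operatorname{Ann}(x)$ and nonzero $s\in\operatorname{Ann}(y)$ with $rs=0$. The weak zero-divisor difference graph $\mathcal D(R)$ is the graph on $Z(R)^*$ with edge set $E(W\Gamma(R))\setminus E(\Gamma(R))$, with resulting isolated vertices deleted. $\omega(G)$ is the clique number of $G$. *)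

theory Defs
  imports "HOL-Algebra.Algebra" "HOL-Library.Ramsey"
begin

text \<open>A simple graph is a pair of a vertex set and a set of edges, each edge being an
  unordered pair of distinct vertices.\<close>

type_synonym 'v graph = "'v set \<times> 'v set set"

definition vertices :: "'v graph \<Rightarrow> 'v set"
  where "vertices G = fst G"

definition edges :: "'v graph \<Rightarrow> 'v set set"
  where "edges G = snd G"

text \<open>Meaningful for finite graphs only, since the maximum is taken over a set of naturals.\<close>

definition clique_number :: "'v graph \<Rightarrow> nat"
  where "clique_number G = Max {card K | K. K \<subseteq> vertices G \<and> clique K (edges G)}"

definition delete_isolated :: "'v graph \<Rightarrow> 'v graph"
  where "delete_isolated G = ({v \<in> vertices G. \<exists>e\<in>edges G. v \<in> e}, edges G)"

text \<open>The notions below are intended for commutative rings, so left and right need not be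
  distinguished. Zero counts as a zero-divisor (of a nonzero ring).\<close>

definition zero_divisors :: "('a, 'm) ring_scheme \<Rightarrow> 'a set"
  where "zero_divisors R =
    {x \<in> carrier R. \<exists>y \<in> carrier R - {\<zero>\<^bsub>R\<^esub>}. x \<otimes>\<^bsub>R\<^esub> y = \<zero>\<^bsub>R\<^esub>}"

definition nonzero_zero_divisors :: "('a, 'm) ring_scheme \<Rightarrow> 'a set"
  where "nonzero_zero_divisors R = zero_divisors R - {\<zero>\<^bsub>R\<^esub>}"

definition annihilator :: "('a, 'm) ring_scheme \<Rightarrow> 'a \<Rightarrow> 'a set"
  where "annihilator R x = {r \<in> carrier R. r \<otimes>\<^bsub>R\<^esub> x = \<zero>\<^bsub>R\<^esub>}"

definition zero_divisor_graph :: "('a, 'm) ring_scheme \<Rightarrow> 'a graph"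
  where "zero_divisor_graph R =
    (nonzero_zero_divisors R,
     {{x, y} | x y. x \<in> nonzero_zero_divisors R \<and> y \<in> nonzero_zero_divisors R \<and> x \<noteq> y \<and>
        x \<otimes>\<^bsub>R\<^esub> y = \<zero>\<^bsub>R\<^esub>})"

definition weak_zero_divisor_graph :: "('a, 'm) ring_scheme \<Rightarrow> 'a graph"
  where "weak_zero_divisor_graph R =
    (nonzero_zero_divisors R,
     {{x, y} | x y. x \<in> nonzero_zero_divisors R \<and> y \<in> nonzero_zero_divisors R \<and> x \<noteq> y \<and>
        (\<exists>r \<in> annihilator R x - {\<zero>\<^bsub>R\<^esub>}. \<exists>s \<in> annihilator R y - {\<zero>\<^bsub>R\<^esub>}.
           r \<otimes>\<^bsub>R\<^esub> s = \<zero>\<^bsub>R\<^esub>)})"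

definition weak_zero_divisor_difference_graph :: "('a, 'm) ring_scheme \<Rightarrow> 'a graph"
  where "weak_zero_divisor_difference_graph R =
    delete_isolated
      (nonzero_zero_divisors R,
       edges (weak_zero_divisor_graph R) - edges (zero_divisor_graph R))"

definition Star :: "(nat \<Rightarrow> nat) \<Rightarrow> nat \<Rightarrow> nat"
  where "Star q k = (q k - 1) * (1 + (\<Sum>j \<in> {1..4} - {k}. (q j - 1))) + 3"

definition Tri :: "(nat \<Rightarrow> nat) \<Rightarrow> nat \<Rightarrow> nat"
  where "Tri q i = (\<Sum>P \<in> nsets ({1..4} - {i}) 2. \<Prod>x\<in>P. (q x - 1)) + 4"

end

theory Submission
  imports Defs
begin

text \<open>
  An element of a product of fields is described, up to everything the graphs can see, by its
  support: two elements multiply to zero iff their supports are disjoint. Hence distinct nonzero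
  zero-divisors are adjacent in the difference graph iff their supports meet and they do not both
  have the same support, missing exactly one index. A maximum clique therefore consists of
  the elements supported on the members of an intersecting family, where every support missing
  exactly one index contributes one element only. On four indices such a family contains a
  singleton \<open>{k}\<close>, and then all its members contain \<open>k\<close>; or its pairs all pass through a common
  point \<open>k\<close>, in which case trading one triple for \<open>{k}\<close> loses nothing; or its pairs
  lie in a triangle.
\<close>

section \<open>Supports and adjacency\<close>

text \<open>The case \<open>S = T\<close> is included on purpose: it forbids the empty support,
  which belongs to zero, just as \<open>I\<close> is removed because full support means not a
  zero-divisor.\<close>

definition intersecting :: "'i set \<Rightarrow> 'i set set \<Rightarrow> bool"
  where "intersecting I F \<longleftrightarrow> F \<subseteq> Pow I - {I} \<and> (\<forall>S\<in>F. \<forall>T\<in>F. S \<inter> T \<noteq> {})"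

text \<open>Everything the graphs can see of the ring, so that the passage to set families never
  touches coordinates. By \<open>supp_image\<close>, every subset of \<open>I\<close> is a
  support.\<close>

locale support_ring =
  fixes R :: "('r, 'm) ring_scheme" and I :: "'i set" and supp :: "'r \<Rightarrow> 'i set"
  assumes finite_index: "finite I"
    and finite_carrier: "finite (carrier R)"
    and supp_image: "supp ` carrier R = Pow I"
    and supp_empty_iff: "x \<in> carrier R \<Longrightarrow> supp x = {} \<longleftrightarrow> x = \<zero>\<^bsub>R\<^esub>"
    and mult_eq_zero_iff: "\<lbrakk>x \<in> carrier R; y \<in> carrier R\<rbrakk> \<Longrightarrow>
      x \<otimes>\<^bsub>R\<^esub> y = \<zero>\<^bsub>R\<^esub> \<longleftrightarrow> supp x \<inter> supp y = {}"
begin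

lemma supp_subset: "x \<in> carrier R \<Longrightarrow> supp x \<subseteq> I"
  using supp_image by blast

lemma obtain_supp:
  assumes "S \<subseteq> I"
  obtains x where "x \<in> carrier R" "supp x = S"
  using assms supp_image by (metis PowI imageE)

text \<open>An element supported exactly on the complement of \<open>supp x\<close> kills
  \<open>x\<close>, and it is nonzero precisely when that complement is nonempty.\<close>

lemma nonzero_zero_divisors_eq:
  "nonzero_zero_divisors R = {x \<in> carrier R. supp x \<noteq> {} \<and> supp x \<noteq> I}"
proof (intro subset_antisym subsetI)
  fix x assume "x \<in> nonzero_zero_divisors R"
  then obtain y where x: "x \<in> carrier R" "x \<noteq> \<zero>\<^bsub>R\<^esub>"
    and y: "y \<in> carrier R" "y \<noteq> \<zero>\<^bsub>R\<^esub>" "x \<otimes>\<^bsub>R\<^esub> y = \<zero>\<^bsub>R\<^esub>"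
    by (auto simp: nonzero_zero_divisors_def zero_divisors_def)
  then have "supp x \<inter> supp y = {}" "supp x \<noteq> {}" "supp y \<noteq> {}"
    using mult_eq_zero_iff supp_empty_iff by auto
  with x y supp_subset[of y] show "x \<in> {x \<in> carrier R. supp x \<noteq> {} \<and> supp x \<noteq> I}"
    by blast
next
  fix x assume "x \<in> {x \<in> carrier R. supp x \<noteq> {} \<and> supp x \<noteq> I}"
  then have x: "x \<in> carrier R" "supp x \<noteq> {}" "supp x \<noteq> I" by auto
  obtain y where y: "y \<in> carrier R" "supp y = I - supp x"
    using obtain_supp[of "I - supp x"] by blast
  have "supp y \<noteq> {}" using x y supp_subset[of x] by blast
  then have "y \<noteq> \<zero>\<^bsub>R\<^esub>" using y supp_empty_iff by blast
  moreover have "x \<otimes>\<^bsub>R\<^esub> y = \<zero>\<^bsub>R\<^esub>" using x y mult_eq_zero_iff by auto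
  ultimately show "x \<in> nonzero_zero_divisors R"
    using x y supp_empty_iff[of x] by (auto simp: nonzero_zero_divisors_def zero_divisors_def)
qed

lemma annihilator_eq:
  assumes "x \<in> carrier R"
  shows "annihilator R x - {\<zero>\<^bsub>R\<^esub>} = {r \<in> carrier R. supp r \<noteq> {} \<and> supp r \<inter> supp x = {}}"
  using assms mult_eq_zero_iff supp_empty_iff by (auto simp: annihilator_def)

text \<open>Nonzero annihilators of \<open>x\<close> are the elements with nonempty support inside
  \<open>I - supp x\<close>. Disjoint supports of this kind exist for \<open>x\<close> and
  \<open>y\<close> unless both complements are one and the same singleton.\<close>

lemma disjoint_annihilators_iff:
  assumes "x \<in> nonzero_zero_divisors R" "y \<in> nonzero_zero_divisors R"
  shows "(\<exists>r \<in> annihilator R x - {\<zero>\<^bsub>R\<^esub>}. \<exists>s \<in> annihilator R y - {\<zero>\<^bsub>R\<^esub>}.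
           r \<otimes>\<^bsub>R\<^esub> s = \<zero>\<^bsub>R\<^esub>)
         \<longleftrightarrow> \<not> (supp x = supp y \<and> card (I - supp x) = 1)" (is "?L \<longleftrightarrow> ?R")
proof
  assume ?L
  then obtain r s where rs: "r \<in> annihilator R x - {\<zero>\<^bsub>R\<^esub>}" "s \<in> annihilator R y - {\<zero>\<^bsub>R\<^esub>}"
    "r \<otimes>\<^bsub>R\<^esub> s = \<zero>\<^bsub>R\<^esub>" by blast
  have xy: "x \<in> carrier R" "y \<in> carrier R"
    using assms by (auto simp: nonzero_zero_divisors_eq)
  have rs': "r \<in> carrier R" "supp r \<noteq> {}" "supp r \<subseteq> I - supp x"
            "s \<in> carrier R" "supp s \<noteq> {}" "supp s \<subseteq> I - supp y"
    using rs xy annihilator_eq supp_subset[of r] supp_subset[of s] by auto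
  have "supp r \<inter> supp s = {}" using rs(3) rs' mult_eq_zero_iff by blast
  \<comment> \<open>If both complements were the same singleton, \<open>supp r\<close> and
    \<open>supp s\<close> would both equal it and so would meet.\<close>
  with rs' show ?R by (metis card_1_singletonE inf.idem subset_singleton_iff)
next
  assume R: ?R
  have xy: "x \<in> carrier R" "y \<in> carrier R" "supp x \<subset> I" "supp y \<subset> I"
    using assms supp_subset by (auto simp: nonzero_zero_divisors_eq)
  \<comment> \<open>Two distinct points suffice, since elements supported on \<open>{i}\<close> and
    \<open>{j}\<close> multiply to zero.\<close>
  have "\<exists>i\<in>I - supp x. \<exists>j\<in>I - supp y. i \<noteq> j"
  proof -
    obtain i where i: "i \<in> I - supp x" using xy by blast
    obtain j where j: "j \<in> I - supp y" using xy by blast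
    have "\<not> (I - supp x = {i} \<and> I - supp y = {i})"
    proof
      assume *: "I - supp x = {i} \<and> I - supp y = {i}"
      then have "supp x = supp y"
        using xy by (metis double_diff psubset_imp_subset subset_refl)
      with * R show False by simp
    qed
    then obtain k where "k \<noteq> i" "k \<in> I - supp x \<or> k \<in> I - supp y"
      using i j by (metis insertI1 singletonD subsetI subset_singletonD empty_iff)
    with i j show ?thesis by metis
  qed
  then obtain i j where ij: "i \<in> I - supp x" "j \<in> I - supp y" "i \<noteq> j" by blast
  obtain r where r: "r \<in> carrier R" "supp r = {i}" using ij obtain_supp[of "{i}"] by blast
  obtain s where s: "s \<in> carrier R" "supp s = {j}" using ij obtain_supp[of "{j}"] by blast
  have "r \<otimes>\<^bsub>R\<^esub> s = \<zero>\<^bsub>R\<^esub>" using r s ij mult_eq_zero_iff by auto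
  moreover have "r \<in> annihilator R x - {\<zero>\<^bsub>R\<^esub>}" "s \<in> annihilator R y - {\<zero>\<^bsub>R\<^esub>}"
    using r s ij xy by (auto simp: annihilator_eq)
  ultimately show ?L by blast
qed

lemma edge_difference_graph_iff:
  "{x, y} \<in> edges (weak_zero_divisor_difference_graph R) \<longleftrightarrow>
     x \<in> nonzero_zero_divisors R \<and> y \<in> nonzero_zero_divisors R \<and> x \<noteq> y \<and>
     supp x \<inter> supp y \<noteq> {} \<and> \<not> (supp x = supp y \<and> card (I - supp x) = 1)"
proof -
  let ?Z = "nonzero_zero_divisors R"
  have E: "edges (weak_zero_divisor_difference_graph R) =
    {{x, y} | x y. x \<in> ?Z \<and> y \<in> ?Z \<and> x \<noteq> y \<and> \<not> (supp x = supp y \<and> card (I - supp x) = 1)}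
    - {{x, y} | x y. x \<in> ?Z \<and> y \<in> ?Z \<and> x \<noteq> y \<and> supp x \<inter> supp y = {}}"
  proof -
    have "x \<otimes>\<^bsub>R\<^esub> y = \<zero>\<^bsub>R\<^esub> \<longleftrightarrow> supp x \<inter> supp y = {}" if "x \<in> ?Z" "y \<in> ?Z" for x y
      using that mult_eq_zero_iff by (simp add: nonzero_zero_divisors_eq)
    then show ?thesis
      unfolding weak_zero_divisor_difference_graph_def delete_isolated_def
        weak_zero_divisor_graph_def zero_divisor_graph_def edges_def snd_conv
      by (simp add: disjoint_annihilators_iff cong: conj_cong)
  qed
  show ?thesis
    \<comment> \<open>The conditions on supports are symmetric in \<open>x\<close> and
      \<open>y\<close>, so reading the unordered pair in either order gives the same answer.\<close>
    unfolding E by (auto simp: doubleton_eq_iff)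
qed

lemma vertices_difference_graph_subset:
  "vertices (weak_zero_divisor_difference_graph R) \<subseteq> carrier R"
  by (auto simp: weak_zero_divisor_difference_graph_def delete_isolated_def vertices_def
      nonzero_zero_divisors_eq)

section \<open>Cliques as weighted intersecting families\<close>

definition fiber :: "'i set \<Rightarrow> 'r set"
  where "fiber S = {x \<in> carrier R. supp x = S}"

text \<open>For a nonempty proper \<open>S\<close>, the largest number of elements of support
  \<open>S\<close> that one clique can hold.\<close>

definition weight :: "'i set \<Rightarrow> nat"
  where "weight S = (if card (I - S) = 1 then 1 else card (fiber S))"

lemma finite_intersecting: "intersecting I F \<Longrightarrow> finite F"
  unfolding intersecting_def using finite_index by (meson finite_Diff finite_Pow_iff finite_subset)

text \<open>The value 1 is available because every subset of \<open>I\<close> is the support of some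
  element.\<close>

lemma weight_le_card_fiber:
  assumes "S \<subseteq> I" shows "weight S \<le> card (fiber S)"
proof -
  have "fiber S \<noteq> {}" "finite (fiber S)"
    using obtain_supp[OF assms] finite_carrier by (auto simp: fiber_def)
  then have "1 \<le> card (fiber S)" by (simp add: Suc_le_eq card_gt_0_iff)
  then show ?thesis by (simp add: weight_def)
qed

text \<open>The supports of the members of \<open>K\<close> serve as \<open>F\<close>;
  \<open>K\<close> splits into its parts of equal support, each bounded by the weight.\<close>

lemma clique_card_le_weight:
  assumes V: "K \<subseteq> vertices (weak_zero_divisor_difference_graph R)"
    and K: "clique K (edges (weak_zero_divisor_difference_graph R))"
  shows "\<exists>F. intersecting I F \<and> card K \<le> sum weight F"
proof (intro exI conjI)
  let ?F = "supp ` K"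
  have KZ: "K \<subseteq> nonzero_zero_divisors R"
    using V by (auto simp: weak_zero_divisor_difference_graph_def delete_isolated_def vertices_def)
  have Kc: "K \<subseteq> carrier R" using KZ by (auto simp: nonzero_zero_divisors_eq)
  have adj: "supp x \<inter> supp y \<noteq> {} \<and> \<not> (supp x = supp y \<and> card (I - supp x) = 1)"
    if "x \<in> K" "y \<in> K" "x \<noteq> y" for x y
    using K that unfolding clique_def edge_difference_graph_iff by blast
  show int: "intersecting I ?F"
  proof -
    have "supp x \<inter> supp y \<noteq> {}" if "x \<in> K" "y \<in> K" for x y
      using that adj[of x y] KZ by (cases "x = y") (auto simp: nonzero_zero_divisors_eq)
    moreover have "?F \<subseteq> Pow I - {I}" using KZ supp_subset by (auto simp: nonzero_zero_divisors_eq)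
    ultimately show ?thesis unfolding intersecting_def by blast
  qed
  \<comment> \<open>When \<open>S\<close> misses one index, distinct elements of support
    \<open>S\<close> are not adjacent, so \<open>K\<close> has at most one of them.\<close>
  have le: "card (K \<inter> fiber S) \<le> weight S" for S
  proof (cases "card (I - S) = 1")
    case True
    have "x = y" if "x \<in> K \<inter> fiber S" "y \<in> K \<inter> fiber S" for x y
      using that True adj[of x y] by (auto simp: fiber_def)
    then show ?thesis
      using True finite_carrier by (auto simp: weight_def fiber_def card_le_Suc0_iff_eq)
  next
    case False
    then show ?thesis
      using finite_carrier by (auto simp: weight_def fiber_def intro: card_mono)
  qed
  have "K = (\<Union>S\<in>?F. K \<inter> fiber S)" using Kc by (auto simp: fiber_def)
  then have "card K \<le> (\<Sum>S\<in>?F. card (K \<inter> fiber S))"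
    using card_UN_le[OF finite_intersecting[OF int], of "\<lambda>S. K \<inter> fiber S"] by simp
  also have "\<dots> \<le> sum weight ?F" by (rule sum_mono) (rule le)
  finally show "card K \<le> sum weight ?F" .
qed

text \<open>Taking \<open>weight S\<close> elements of each support \<open>S\<close> attains the
  bound. Total weight at least 2 is required because a lone vertex could be isolated and hence
  deleted.\<close>

lemma intersecting_imp_clique:
  assumes F: "intersecting I F" and two: "2 \<le> sum weight F"
  shows "\<exists>K. K \<subseteq> vertices (weak_zero_divisor_difference_graph R) \<and>
    clique K (edges (weak_zero_divisor_difference_graph R)) \<and> card K = sum weight F"
proof -
  have "\<forall>S\<in>F. \<exists>B. B \<subseteq> fiber S \<and> card B = weight S"
  proof
    fix S assume "S \<in> F"
    then have "weight S \<le> card (fiber S)"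
      using F weight_le_card_fiber by (auto simp: intersecting_def)
    then show "\<exists>B. B \<subseteq> fiber S \<and> card B = weight S"
      by (meson obtain_subset_with_card_n)
  qed
  then obtain B where B: "\<And>S. S \<in> F \<Longrightarrow> B S \<subseteq> fiber S" "\<And>S. S \<in> F \<Longrightarrow> card (B S) = weight S"
    by metis
  define K where "K = (\<Union>S\<in>F. B S)"
  have finB: "finite (B S)" if "S \<in> F" for S
    using B(1)[OF that] finite_carrier by (auto simp: fiber_def intro: finite_subset)
  have card: "card K = sum weight F"
  proof -
    have "B S \<inter> B T = {}" if "S \<in> F" "T \<in> F" "S \<noteq> T" for S T
      using B(1)[OF that(1)] B(1)[OF that(2)] that(3) by (auto simp: fiber_def)
    then have "card K = (\<Sum>S\<in>F. card (B S))"
      unfolding K_def using finB finite_intersecting[OF F] by (intro card_UN_disjoint) auto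
    then show ?thesis using B(2) by simp
  qed
  have suppK: "x \<in> carrier R \<and> supp x \<in> F \<and> x \<in> B (supp x)" if "x \<in> K" for x
    using that B(1) by (fastforce simp: K_def fiber_def)
  have KZ: "x \<in> nonzero_zero_divisors R" if "x \<in> K" for x
    using suppK[OF that] F by (fastforce simp: intersecting_def nonzero_zero_divisors_eq)
  have edge: "{x, y} \<in> edges (weak_zero_divisor_difference_graph R)"
    if "x \<in> K" "y \<in> K" "x \<noteq> y" for x y
  proof -
    have "supp x \<inter> supp y \<noteq> {}"
      using suppK[OF that(1)] suppK[OF that(2)] F by (auto simp: intersecting_def)
    \<comment> \<open>A support missing one index contributed a single element, so \<open>x\<close>
      and \<open>y\<close> would coincide.\<close>
    moreover have False if *: "supp x = supp y" "card (I - supp x) = 1"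
    proof -
      have "card (B (supp x)) \<le> Suc 0"
        using B(2)[of "supp x"] suppK[OF \<open>x \<in> K\<close>] *(2) by (simp add: weight_def)
      then show False
        using suppK[OF \<open>x \<in> K\<close>] suppK[OF \<open>y \<in> K\<close>] * \<open>x \<noteq> y\<close> finB[of "supp x"]
        by (auto simp: card_le_Suc0_iff_eq)
    qed
    ultimately show ?thesis
      using KZ that by (auto simp: edge_difference_graph_iff)
  qed
  have "K \<subseteq> vertices (weak_zero_divisor_difference_graph R)"
  proof
    fix x assume x: "x \<in> K"
    \<comment> \<open>A second member of \<open>K\<close> is a neighbour of \<open>x\<close>, so
      \<open>x\<close> survives the deletion of isolated vertices.\<close>
    have "\<not> K \<subseteq> {x}" using card two card_mono[of "{x}" K] by auto
    then obtain y where "y \<in> K" "x \<noteq> y" by blast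
    with edge x have "{x, y} \<in> edges (weak_zero_divisor_difference_graph R)" by blast
    with KZ[OF x] show "x \<in> vertices (weak_zero_divisor_difference_graph R)"
      by (auto simp: weak_zero_divisor_difference_graph_def delete_isolated_def
          vertices_def edges_def)
  qed
  moreover have "clique K (edges (weak_zero_divisor_difference_graph R))"
    using edge by (auto simp: clique_def)
  ultimately show ?thesis using card by blast
qed

text \<open>Combines both directions: the clique number becomes the maximum of
  \<open>sum weight\<close> over intersecting families.\<close>

lemma clique_number_eqI:
  assumes upper: "\<And>F. intersecting I F \<Longrightarrow> sum weight F \<le> n"
    and F: "intersecting I F" "sum weight F = n" and "2 \<le> n"
  shows "clique_number (weak_zero_divisor_difference_graph R) = n"
proof -
  let ?G = "weak_zero_divisor_difference_graph R"
  have "finite {card K | K. K \<subseteq> vertices ?G \<and> clique K (edges ?G)}"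
  proof (rule finite_subset)
    have "finite (vertices ?G)"
      by (rule finite_subset[OF vertices_difference_graph_subset finite_carrier])
    then show "finite (card ` Pow (vertices ?G))" by simp
    show "{card K | K. K \<subseteq> vertices ?G \<and> clique K (edges ?G)} \<subseteq> card ` Pow (vertices ?G)"
      by auto
  qed
  then show ?thesis
    unfolding clique_number_def
  proof (rule Max_eqI)
    show "k \<le> n" if k: "k \<in> {card K | K. K \<subseteq> vertices ?G \<and> clique K (edges ?G)}" for k
    proof -
      obtain K where "K \<subseteq> vertices ?G" "clique K (edges ?G)" "k = card K" using k by blast
      then show ?thesis using clique_card_le_weight[of K] upper by (metis order_trans)
    qed
    show "n \<in> {card K | K. K \<subseteq> vertices ?G \<and> clique K (edges ?G)}"
      using intersecting_imp_clique[OF F(1)] \<open>2 \<le> n\<close> unfolding F(2) by blast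
  qed
qed

end

section \<open>Weights of families of subsets of \<open>{1..4}\<close>\<close>

text \<open>The value of \<open>weight\<close> for four fields of orders \<open>q i\<close>: missing
  one of four indices means having three elements, and each index of the support allows
  \<open>q i - 1\<close> nonzero entries.\<close>

definition weight4 :: "(nat \<Rightarrow> nat) \<Rightarrow> nat set \<Rightarrow> nat"
  where "weight4 q S = (if card S = 3 then 1 else \<Prod>i\<in>S. (q i - 1))"

text \<open>This family and \<open>tri_family\<close> are the candidates for maximum weight; they
  realise \<open>Star q k\<close> and \<open>Tri q i\<close>.\<close>

definition star_family :: "nat \<Rightarrow> nat set set"
  where "star_family k = {S \<in> Pow {1..4} - {{1..4}}. k \<in> S}"

definition tri_family :: "nat \<Rightarrow> nat set set"
  where "tri_family i = nsets ({1..4} - {i}) 2 \<union> nsets {1..4} 3"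

lemma nsets_pairs_through:
  assumes "k \<in> A" "finite A"
  shows "{S \<in> nsets A 2. k \<in> S} = (\<lambda>j. {k, j}) ` (A - {k})"
  using assms by (auto simp: nsets_def card_2_iff image_iff)

lemma nsets_pairs_4: "nsets {1..4::nat} 2 = {{1,2},{1,3},{1,4},{2,3},{2,4},{3,4}}"
proof -
  have "S \<in> {{1,2},{1,3},{1,4},{2,3},{2,4},{3,4}}" if S: "S \<in> nsets {1..4::nat} 2" for S
  proof -
    obtain x y where "S = {x, y}" "x \<in> {1..4}" "y \<in> {1..4}" "x < y"
      using S unfolding ordered_nsets_2_eq by blast
    moreover from this have "x = 1 \<or> x = 2 \<or> x = 3" "y = 2 \<or> y = 3 \<or> y = 4" by auto
    ultimately show ?thesis by (elim disjE) simp_all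
  qed
  moreover have "{{1,2},{1,3},{1,4},{2,3},{2,4},{3,4}} \<subseteq> nsets {1..4::nat} 2"
    by (simp add: doubleton_in_nsets_2)
  ultimately show ?thesis by (intro equalityI subsetI) (assumption | erule subsetD)+
qed

lemma sum_weight4_pairs_through:
  assumes "k \<in> {1..4}"
  shows "sum (weight4 q) {S \<in> nsets {1..4} 2. k \<in> S} = (q k - 1) * (\<Sum>j\<in>{1..4} - {k}. (q j - 1))"
proof -
  \<comment> \<open>A pair through \<open>k\<close> is indexed by its other point \<open>j\<close>,
    which turns the sum over pairs into the sum in \<open>Star\<close>.\<close>
  have inj: "inj_on (\<lambda>j. {k, j}) ({1..4} - {k})"
    by (auto simp: inj_on_def doubleton_eq_iff)
  have "weight4 q {k, j} = (q k - 1) * (q j - 1)" if "j \<noteq> k" for j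
    using that by (simp add: weight4_def)
  then have "(\<Sum>j\<in>{1..4} - {k}. weight4 q {k, j}) = (q k - 1) * (\<Sum>j\<in>{1..4} - {k}. (q j - 1))"
    unfolding sum_distrib_left by (intro sum.cong) auto
  then show ?thesis
    by (simp only: nsets_pairs_through[OF assms finite_atLeastAtMost] sum.reindex[OF inj] o_def)
qed

lemma sum_weight4_triples: "T \<subseteq> nsets {1..4} 3 \<Longrightarrow> sum (weight4 q) T = card T"
  by (subst card_eq_sum, rule sum.cong) (auto simp: weight4_def nsets_def)

lemma card_nsets_triples: "card (nsets {1..4::nat} 3) = 4"
  by (simp add: binomial_eq_nsets[symmetric] numeral_eq_Suc)

text \<open>Of the four triples only \<open>{1..4} - {k}\<close> avoids \<open>k\<close>.\<close>

lemma card_triples_through: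
  assumes "k \<in> {1..4::nat}"
  shows "card {S \<in> nsets {1..4} 3. k \<in> S} = 3"
proof -
  have "nsets {1..4} 3 = {S \<in> nsets {1..4} 3. k \<in> S} \<union> nsets ({1..4} - {k}) 3"
    by (auto simp: nsets_def)
  moreover have "{S \<in> nsets {1..4} 3. k \<in> S} \<inter> nsets ({1..4} - {k}) 3 = {}"
    by (auto simp: nsets_def)
  ultimately have "card (nsets {1..4::nat} 3) =
      card {S \<in> nsets {1..4} 3. k \<in> S} + card (nsets ({1..4} - {k}) 3)"
    by (metis card_Un_disjoint finite_Un finite_atLeastAtMost finite_imp_finite_nsets)
  moreover have "card (nsets ({1..4} - {k}) 3) = 1"
    using assms by simp
  ultimately show ?thesis
    unfolding card_nsets_triples by simp
qed

lemma subset4_cases: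
  assumes "S \<in> Pow {1..4::nat} - {{1..4}}" "S \<noteq> {}"
  obtains k where "k \<in> {1..4}" "S = {k}" | "S \<in> nsets {1..4} 2" | "S \<in> nsets {1..4} 3"
proof -
  have S: "finite S" "S \<subset> {1..4}" using assms by (auto intro: finite_subset)
  then have "card S < 4" using psubset_card_mono[of "{1..4::nat}" S] by simp
  moreover have "card S \<noteq> 0" using assms S by simp
  ultimately have "card S = 1 \<or> card S = 2 \<or> card S = 3" by linarith
  then show thesis
    using that S by (auto simp: nsets_def card_1_singleton_iff)
qed

text \<open>Sorting by size matches the terms of \<open>Star\<close>: the singleton gives the 1 in
  the bracket, the pairs give the sum, and the triples give the final 3.\<close>

lemma star_family_eq:
  assumes "k \<in> {1..4}"
  shows "star_family k = insert {k} ({S \<in> nsets {1..4} 2. k \<in> S} \<union> {S \<in> nsets {1..4} 3. k \<in> S})"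
    (is "?L = ?R")
proof
  show "?L \<subseteq> ?R"
  proof
    fix S assume S: "S \<in> ?L"
    then have "S \<in> Pow {1..4} - {{1..4}}" "S \<noteq> {}" "k \<in> S" by (auto simp: star_family_def)
    then show "S \<in> ?R" by (cases S rule: subset4_cases) auto
  qed
  show "?R \<subseteq> ?L"
  proof
    fix S assume "S \<in> ?R"
    then have "S \<subseteq> {1..4}" "k \<in> S" "card S < card {1..4::nat}"
      using assms by (auto simp: nsets_def)
    then show "S \<in> ?L" unfolding star_family_def by blast
  qed
qed

lemma sum_star_family:
  assumes k: "k \<in> {1..4}"
  shows "sum (weight4 q) (star_family k) = Star q k"
proof -
  let ?P = "{S \<in> nsets {1..4} 2. k \<in> S}" and ?T = "{S \<in> nsets {1..4} 3. k \<in> S}"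
  have fin: "finite ?P" "finite ?T" by (simp_all add: finite_imp_finite_nsets)
  have "?P \<inter> ?T = {}" "{k} \<notin> ?P \<union> ?T" by (auto simp: nsets_def)
  with fin have "sum (weight4 q) (star_family k) =
      weight4 q {k} + (sum (weight4 q) ?P + sum (weight4 q) ?T)"
    unfolding star_family_eq[OF k] by (simp add: sum.union_disjoint)
  also have "weight4 q {k} = q k - 1" by (simp add: weight4_def)
  also have "sum (weight4 q) ?T = 3"
    using sum_weight4_triples[of ?T] card_triples_through[OF k] by simp
  finally show ?thesis
    by (simp only: sum_weight4_pairs_through[OF k] Star_def) simp
qed

text \<open>The constant 4 in \<open>Tri\<close> counts the four triples, each of weight 1.\<close>

lemma sum_tri_family: "sum (weight4 q) (tri_family i) = Tri q i"
proof -
  let ?P = "nsets ({1..4} - {i}) 2" and ?T = "nsets {1..4::nat} 3"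
  have "?P \<inter> ?T = {}" by (auto simp: nsets_def)
  then have "sum (weight4 q) (tri_family i) = sum (weight4 q) ?P + sum (weight4 q) ?T"
    unfolding tri_family_def by (simp add: sum.union_disjoint finite_imp_finite_nsets)
  also have "sum (weight4 q) ?T = 4"
    using sum_weight4_triples[of ?T] card_nsets_triples by simp
  also have "sum (weight4 q) ?P = (\<Sum>P\<in>?P. \<Prod>x\<in>P. (q x - 1))"
    by (rule sum.cong) (auto simp: weight4_def nsets_def)
  finally show ?thesis by (simp add: Tri_def)
qed

section \<open>Intersecting families on four indices\<close>

lemma intersecting_star_family: "k \<in> {1..4} \<Longrightarrow> intersecting {1..4} (star_family k)"
  by (auto simp: intersecting_def star_family_def)

text \<open>Pure counting: disjoint members have at least two elements each and at most four
  together, so both are pairs; but two disjoint pairs do not fit into the three points other than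
  \<open>i\<close>.\<close>

lemma intersecting_tri_family:
  assumes "i \<in> {1..4}"
  shows "intersecting {1..4} (tri_family i)"
proof -
  have sub: "finite S \<and> S \<subseteq> {1..4} \<and> (card S = 3 \<or> card S = 2 \<and> S \<subseteq> {1..4} - {i})"
    if "S \<in> tri_family i" for S
    using that by (auto simp: tri_family_def nsets_def)
  have "S \<inter> T \<noteq> {}" if "S \<in> tri_family i" "T \<in> tri_family i" for S T
  proof
    assume "S \<inter> T = {}"
    then have c: "card (S \<union> T) = card S + card T"
      using sub[OF that(1)] sub[OF that(2)] by (simp add: card_Un_disjoint)
    have "card (S \<union> T) \<le> 4"
      using sub[OF that(1)] sub[OF that(2)] card_mono[of "{1..4::nat}" "S \<union> T"] by simp
    with c have "card S = 2" "card T = 2" using sub[OF that(1)] sub[OF that(2)] by linarith+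
    then have "card (S \<union> T) \<le> card ({1..4} - {i})"
      using sub[OF that(1)] sub[OF that(2)] by (intro card_mono) auto
    with c \<open>card S = 2\<close> \<open>card T = 2\<close> assms show False by simp
  qed
  moreover have "tri_family i \<subseteq> Pow {1..4} - {{1..4}}"
    using sub by fastforce
  ultimately show ?thesis by (auto simp: intersecting_def)
qed

text \<open>Of each complementary couple of pairs only one can occur, and each of the eight possible
  choices gives either the three pairs through a point or the three sides of a triangle.\<close>
lemma intersecting_pairs_4:
  assumes "P \<subseteq> nsets {1..4::nat} 2" and int: "\<And>S T. S \<in> P \<Longrightarrow> T \<in> P \<Longrightarrow> S \<inter> T \<noteq> {}"
  obtains k where "k \<in> {1..4}" "P \<subseteq> {S. k \<in> S}"
  | i where "i \<in> {1..4}" "P \<subseteq> nsets ({1..4} - {i}) 2"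
proof -
  have I: "{1..4::nat} = {1,2,3,4}" by auto
  have a: "{1,2} \<notin> P \<or> {3,4} \<notin> P" using int[of "{1,2}" "{3,4}"] by auto
  have b: "{1,3} \<notin> P \<or> {2,4} \<notin> P" using int[of "{1,3}" "{2,4}"] by auto
  have c: "{1,4} \<notin> P \<or> {2,3} \<notin> P" using int[of "{1,4}" "{2,3}"] by auto
  have P: "S = {1,2} \<or> S = {1,3} \<or> S = {1,4} \<or> S = {2,3} \<or> S = {2,4} \<or> S = {3,4}" if "S \<in> P" for S
    using subsetD[OF assms(1) that] unfolding nsets_pairs_4 by simp
  \<comment> \<open>Excluding the three pairs that avoid a point leaves only pairs through it;
    excluding the three pairs through a point leaves the triangle opposite to it.\<close>
  have "\<forall>S\<in>P. 1 \<in> S" if "{2,3} \<notin> P" "{2,4} \<notin> P" "{3,4} \<notin> P"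
    by (intro ballI, frule P, elim disjE) (use that in simp_all)
  moreover have "\<forall>S\<in>P. 2 \<in> S" if "{1,3} \<notin> P" "{1,4} \<notin> P" "{3,4} \<notin> P"
    by (intro ballI, frule P, elim disjE) (use that in simp_all)
  moreover have "\<forall>S\<in>P. 3 \<in> S" if "{1,2} \<notin> P" "{1,4} \<notin> P" "{2,4} \<notin> P"
    by (intro ballI, frule P, elim disjE) (use that in simp_all)
  moreover have "\<forall>S\<in>P. 4 \<in> S" if "{1,2} \<notin> P" "{1,3} \<notin> P" "{2,3} \<notin> P"
    by (intro ballI, frule P, elim disjE) (use that in simp_all)
  moreover have "\<forall>S\<in>P. 1 \<notin> S" if "{1,2} \<notin> P" "{1,3} \<notin> P" "{1,4} \<notin> P"
    by (intro ballI, frule P, elim disjE) (use that in simp_all)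
  moreover have "\<forall>S\<in>P. 2 \<notin> S" if "{1,2} \<notin> P" "{2,3} \<notin> P" "{2,4} \<notin> P"
    by (intro ballI, frule P, elim disjE) (use that in simp_all)
  moreover have "\<forall>S\<in>P. 3 \<notin> S" if "{1,3} \<notin> P" "{2,3} \<notin> P" "{3,4} \<notin> P"
    by (intro ballI, frule P, elim disjE) (use that in simp_all)
  moreover have "\<forall>S\<in>P. 4 \<notin> S" if "{1,4} \<notin> P" "{2,4} \<notin> P" "{3,4} \<notin> P"
    by (intro ballI, frule P, elim disjE) (use that in simp_all)
  \<comment> \<open>By \<open>a\<close>, \<open>b\<close> and \<open>c\<close> at least one pair of
    each couple is excluded; the eight ways to choose these are exactly the premises of the eight
    implications.\<close>
  ultimately have "(\<exists>k\<in>{1..4}. \<forall>S\<in>P. k \<in> S) \<or> (\<exists>k\<in>{1..4}. \<forall>S\<in>P. k \<notin> S)"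
    using a b c unfolding I bex_simps by satx
  then show thesis
  proof (elim disjE bexE)
    fix k :: nat assume "k \<in> {1..4}" "\<forall>S\<in>P. k \<in> S"
    then show thesis using that(1) by blast
  next
    fix k :: nat assume k: "k \<in> {1..4}" "\<forall>S\<in>P. k \<notin> S"
    then have "P \<subseteq> nsets ({1..4} - {k}) 2" using assms(1) by (auto simp: nsets_def)
    with k(1) show thesis by (rule that(2))
  qed
qed

text \<open>The bound \<open>2 \<le> q k\<close> makes \<open>{k}\<close> weigh at least 1, as much
  as the triple it replaces.\<close>

lemma sum_weight4_intersecting_le:
  assumes F: "intersecting {1..4} F" and q: "\<And>k. k \<in> {1..4} \<Longrightarrow> 2 \<le> q k"
  shows "(\<exists>k\<in>{1..4}. sum (weight4 q) F \<le> Star q k) \<or> (\<exists>i\<in>{1..4}. sum (weight4 q) F \<le> Tri q i)"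
proof -
  have int: "\<And>S T. S \<in> F \<Longrightarrow> T \<in> F \<Longrightarrow> S \<inter> T \<noteq> {}"
    using F by (auto simp: intersecting_def)
  have fin: "finite (star_family k)" "finite (tri_family k)" for k
    by (auto simp: star_family_def tri_family_def finite_imp_finite_nsets)
  show ?thesis
  proof (cases "\<exists>k. {k} \<in> F")
    case True
    then obtain k where k: "{k} \<in> F" by blast
    then have k4: "k \<in> {1..4}" using F by (auto simp: intersecting_def)
    \<comment> \<open>Every member must meet \<open>{k}\<close> and hence contain
      \<open>k\<close>.\<close>
    have "F \<subseteq> star_family k"
      using F int[OF k] by (auto simp: star_family_def intersecting_def)
    then have "sum (weight4 q) F \<le> Star q k"
      using sum_mono2[OF fin(1), of F k "weight4 q"] sum_star_family[OF k4, of q] by simp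
    with k4 show ?thesis by blast
  next
    case False
    let ?T = "nsets {1..4::nat} 3"
    \<comment> \<open>Without singletons only pairs and triples remain; admitting all four triples
      is harmless for an upper bound.\<close>
    have F23: "F \<subseteq> (F \<inter> nsets {1..4} 2) \<union> ?T"
    proof
      fix S assume S: "S \<in> F"
      then have "S \<in> Pow {1..4} - {{1..4}}" "S \<noteq> {}" using F int by (auto simp: intersecting_def)
      then show "S \<in> (F \<inter> nsets {1..4} 2) \<union> ?T"
        using False S by (cases S rule: subset4_cases) auto
    qed
    have sub: "F \<inter> nsets {1..4} 2 \<subseteq> nsets {1..4} 2" by blast
    have "S \<inter> T \<noteq> {}" if "S \<in> F \<inter> nsets {1..4} 2" "T \<in> F \<inter> nsets {1..4} 2" for S T
      using int that by simp
    then show ?thesis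
    proof (rule intersecting_pairs_4[OF sub])
      fix k :: nat assume k: "k \<in> {1..4}" "F \<inter> nsets {1..4} 2 \<subseteq> {S. k \<in> S}"
      let ?P = "{S \<in> nsets {1..4} 2. k \<in> S}"
      have fin': "finite ?P" "finite ?T" by (simp_all add: finite_imp_finite_nsets)
      have "sum (weight4 q) F \<le> sum (weight4 q) (?P \<union> ?T)"
        using k F23 fin' by (intro sum_mono2) auto
      also have "\<dots> \<le> sum (weight4 q) ?P + sum (weight4 q) ?T"
        using sum_Un_nat[OF fin'] by simp
      also have "sum (weight4 q) ?T = 4"
        using sum_weight4_triples[of ?T] card_nsets_triples by simp
      \<comment> \<open>\<open>Star q k\<close> exceeds the weight of the pairs by
        \<open>(q k - 1) + 3\<close>, and \<open>q k - 1\<close> is at least 1.\<close>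
      also have "sum (weight4 q) ?P + 4 \<le> Star q k"
        unfolding sum_weight4_pairs_through[OF k(1)] Star_def
        using q[OF k(1)] by simp
      finally show ?thesis using k(1) by blast
    next
      fix i :: nat assume i: "i \<in> {1..4}" "F \<inter> nsets {1..4} 2 \<subseteq> nsets ({1..4} - {i}) 2"
      then have "F \<subseteq> tri_family i" using F23 by (auto simp: tri_family_def)
      then have "sum (weight4 q) F \<le> Tri q i"
        using sum_mono2[OF fin(2), of F i "weight4 q"] sum_tri_family[of q i] by simp
      with i(1) show ?thesis by blast
    qed
  qed
qed

section \<open>Supports in a product of four fields\<close>

text \<open>The four fields may have different types, so a tuple is not a function of the index and
  its coordinates are listed one by one.\<close>

definition support4 :: "('a, 'm) ring_scheme \<Rightarrow> ('b, 'n) ring_scheme \<Rightarrow> ('c, 'k) ring_scheme \<Rightarrow>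
    ('d, 'l) ring_scheme \<Rightarrow> 'a \<times> 'b \<times> 'c \<times> 'd \<Rightarrow> nat set"
  where "support4 F1 F2 F3 F4 = (\<lambda>(a, b, c, d).
    {i. i = 1 \<and> a \<noteq> \<zero>\<^bsub>F1\<^esub> \<or> i = 2 \<and> b \<noteq> \<zero>\<^bsub>F2\<^esub> \<or> i = 3 \<and> c \<noteq> \<zero>\<^bsub>F3\<^esub> \<or> i = 4 \<and> d \<noteq> \<zero>\<^bsub>F4\<^esub>})"

lemma support4_subset: "support4 F1 F2 F3 F4 x \<subseteq> {1..4}"
  by (auto simp: support4_def)

text \<open>The right-hand side is the vanishing of the product, coordinate by coordinate, when
  there are no zero-divisors in the factors.\<close>

lemma support4_disjoint_iff:
  "support4 F1 F2 F3 F4 (a, b, c, d) \<inter> support4 F1 F2 F3 F4 (a', b', c', d') = {} \<longleftrightarrow>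
    (a = \<zero>\<^bsub>F1\<^esub> \<or> a' = \<zero>\<^bsub>F1\<^esub>) \<and> (b = \<zero>\<^bsub>F2\<^esub> \<or> b' = \<zero>\<^bsub>F2\<^esub>) \<and>
    (c = \<zero>\<^bsub>F3\<^esub> \<or> c' = \<zero>\<^bsub>F3\<^esub>) \<and> (d = \<zero>\<^bsub>F4\<^esub> \<or> d' = \<zero>\<^bsub>F4\<^esub>)"
    (is "?A \<inter> ?B = {} \<longleftrightarrow> _")
proof -
  have I: "{1..4::nat} = {1,2,3,4}" by auto
  have "A \<inter> B = {} \<longleftrightarrow> (\<forall>i\<in>I. i \<notin> A \<or> i \<notin> B)" if "A \<subseteq> I" for A B I :: "nat set"
    using that by blast
  from this[OF support4_subset]
  have "?A \<inter> ?B = {} \<longleftrightarrow> (\<forall>i\<in>{1..4}. i \<notin> ?A \<or> i \<notin> ?B)" .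
  then show ?thesis unfolding I by (simp add: support4_def)
qed

lemma RDirProd_simps:
  "carrier (RDirProd R S) = carrier R \<times> carrier S"
  "\<zero>\<^bsub>RDirProd R S\<^esub> = (\<zero>\<^bsub>R\<^esub>, \<zero>\<^bsub>S\<^esub>)"
  "(a, b) \<otimes>\<^bsub>RDirProd R S\<^esub> (c, d) = (a \<otimes>\<^bsub>R\<^esub> c, b \<otimes>\<^bsub>S\<^esub> d)"
  by (auto simp: RDirProd_def DirProd_def monoid.defs)

lemma (in field) order_ge_2:
  assumes "finite (carrier R)" shows "2 \<le> order R"
  using card_mono[OF assms, of "{\<zero>, \<one>}"] by (simp add: order_def)

text \<open>Prescribing the support constrains each coordinate separately; the box form lets the
  cardinality be read off as a product.\<close>

lemma support4_fiber_eq: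
  assumes "S \<subseteq> {1..4}"
    and "\<zero>\<^bsub>F1\<^esub> \<in> carrier F1" "\<zero>\<^bsub>F2\<^esub> \<in> carrier F2" "\<zero>\<^bsub>F3\<^esub> \<in> carrier F3" "\<zero>\<^bsub>F4\<^esub> \<in> carrier F4"
  shows "{x \<in> carrier (RDirProd F1 (RDirProd F2 (RDirProd F3 F4))). support4 F1 F2 F3 F4 x = S} =
    (if 1 \<in> S then carrier F1 - {\<zero>\<^bsub>F1\<^esub>} else {\<zero>\<^bsub>F1\<^esub>}) \<times>
    (if 2 \<in> S then carrier F2 - {\<zero>\<^bsub>F2\<^esub>} else {\<zero>\<^bsub>F2\<^esub>}) \<times>
    (if 3 \<in> S then carrier F3 - {\<zero>\<^bsub>F3\<^esub>} else {\<zero>\<^bsub>F3\<^esub>}) \<times>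
    (if 4 \<in> S then carrier F4 - {\<zero>\<^bsub>F4\<^esub>} else {\<zero>\<^bsub>F4\<^esub>})"
  (is "?L = ?R")
proof -
  have I: "{1..4::nat} = {1,2,3,4}" by auto
  have eq: "support4 F1 F2 F3 F4 (a, b, c, d) = S \<longleftrightarrow> (1 \<in> S \<longleftrightarrow> a \<noteq> \<zero>\<^bsub>F1\<^esub>) \<and>
      (2 \<in> S \<longleftrightarrow> b \<noteq> \<zero>\<^bsub>F2\<^esub>) \<and> (3 \<in> S \<longleftrightarrow> c \<noteq> \<zero>\<^bsub>F3\<^esub>) \<and> (4 \<in> S \<longleftrightarrow> d \<noteq> \<zero>\<^bsub>F4\<^esub>)" for a b c d
  proof -
    let ?T = "support4 F1 F2 F3 F4 (a, b, c, d)"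
    have "A = B \<longleftrightarrow> (\<forall>i\<in>I. i \<in> B \<longleftrightarrow> i \<in> A)" if "A \<subseteq> I" "B \<subseteq> I" for A B I :: "nat set"
      using that by blast
    from this[OF support4_subset assms(1)]
    have "?T = S \<longleftrightarrow> (\<forall>i\<in>{1..4}. i \<in> S \<longleftrightarrow> i \<in> ?T)" .
    then show ?thesis unfolding I by (simp add: support4_def)
  qed
  show ?thesis
  proof (rule Set.set_eqI)
    fix x
    show "x \<in> ?L \<longleftrightarrow> x \<in> ?R"
    proof (cases x)
      case (fields a b c d)
      show ?thesis
        unfolding fields using assms(2-) by (auto simp: RDirProd_simps eq)
    qed
  qed
qed

section \<open>The clique number for four finite fields\<close>

theorem theorem6p2:
  fixes F1 :: "('a, 'm) ring_scheme" and F2 :: "('b, 'n) ring_scheme"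
    and F3 :: "('c, 'k) ring_scheme" and F4 :: "('d, 'l) ring_scheme"
    and q :: "nat \<Rightarrow> nat"
  assumes "field F1" and "field F2" and "field F3" and "field F4"
    and "finite (carrier F1)" and "finite (carrier F2)"
    and "finite (carrier F3)" and "finite (carrier F4)"
    and "q 1 = order F1" and "q 2 = order F2" and "q 3 = order F3" and "q 4 = order F4"
  shows "clique_number
           (weak_zero_divisor_difference_graph (RDirProd F1 (RDirProd F2 (RDirProd F3 F4)))) =
         max (Max (Star q ` {1..4})) (Max (Tri q ` {1..4}))"
proof -
  interpret F1: field F1 by fact
  interpret F2: field F2 by fact
  interpret F3: field F3 by fact
  interpret F4: field F4 by fact
  let ?R = "RDirProd F1 (RDirProd F2 (RDirProd F3 F4))"
  let ?s = "support4 F1 F2 F3 F4"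
  let ?m = "max (Max (Star q ` {1..4})) (Max (Tri q ` {1..4}))"
  have I: "{1..4::nat} = {1,2,3,4}" by auto
  have q: "2 \<le> q k" if "k \<in> {1..4}" for k
    using that assms F1.order_ge_2 F2.order_ge_2 F3.order_ge_2 F4.order_ge_2
    unfolding I by auto
  have fiber: "card {x \<in> carrier ?R. ?s x = S} = (\<Prod>i\<in>S. (q i - 1))" if "S \<subseteq> {1..4}" for S
  proof -
    \<comment> \<open>The default factor 1 for \<open>i\<close> outside \<open>S\<close> is the size
      of the box side consisting of zero alone.\<close>
    have "(\<Prod>i\<in>S. (q i - 1)) = (\<Prod>i\<in>{1..4}. if i \<in> S then q i - 1 else 1)"
      using that by (subst prod.inter_restrict[symmetric]) (auto simp: Int_absorb1)
    also have "\<dots> = card {x \<in> carrier ?R. ?s x = S}"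
      unfolding I support4_fiber_eq[OF that F1.zero_closed F2.zero_closed F3.zero_closed F4.zero_closed]
      using assms by (simp add: card_cartesian_product order_def)
    finally show ?thesis by simp
  qed
  interpret support_ring ?R "{1..4}" ?s
  proof
    show "?s ` carrier ?R = Pow {1..4}"
    proof
      show "?s ` carrier ?R \<subseteq> Pow {1..4}" using support4_subset by blast
      show "Pow {1..4} \<subseteq> ?s ` carrier ?R"
      proof
        fix S :: "nat set" assume "S \<in> Pow {1..4}"
        then have S: "S \<subseteq> {1..4}" by blast
        \<comment> \<open>Every field has a nonzero element, so no fiber is empty and every subset
          of \<open>{1..4}\<close> occurs as a support.\<close>
        have "0 < q i - 1" if "i \<in> S" for i using q[of i] that S by fastforce
        then have "card {x \<in> carrier ?R. ?s x = S} \<noteq> 0"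
          unfolding fiber[OF S] by (simp add: prod_pos)
        then have "{x \<in> carrier ?R. ?s x = S} \<noteq> {}"
          by (rule contrapos_nn) (simp only: card.empty)
        then show "S \<in> ?s ` carrier ?R" by blast
      qed
    qed
    show "finite (carrier ?R)" using assms by (simp add: RDirProd_simps)
    show "?s x = {} \<longleftrightarrow> x = \<zero>\<^bsub>?R\<^esub>" if "x \<in> carrier ?R" for x
      by (cases x) (auto simp: support4_def RDirProd_simps)
    show "x \<otimes>\<^bsub>?R\<^esub> y = \<zero>\<^bsub>?R\<^esub> \<longleftrightarrow> ?s x \<inter> ?s y = {}" if xy: "x \<in> carrier ?R" "y \<in> carrier ?R" for x y
    proof (cases x; cases y)
      fix a b c d a' b' c' d' assume x: "x = (a, b, c, d)" and y: "y = (a', b', c', d')"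
      show ?thesis
        using xy unfolding x y support4_disjoint_iff
        by (simp add: RDirProd_simps F1.integral_iff F2.integral_iff F3.integral_iff F4.integral_iff)
    qed
  qed simp
  have weight_eq: "sum weight F = sum (weight4 q) F" if "intersecting {1..4} F" for F
  proof (rule sum.cong)
    fix S assume "S \<in> F"
    then have S: "S \<subseteq> {1..4}" using that by (auto simp: intersecting_def)
    then have "card ({1..4} - S) = 4 - card S" "card S \<le> 4"
      using card_mono[of "{1..4::nat}" S] by (auto simp: card_Diff_subset finite_subset)
    then have "card ({1..4} - S) = 1 \<longleftrightarrow> card S = 3" by auto
    then show "weight S = weight4 q S"
      by (simp only: weight_def weight4_def fiber_def fiber[OF S])
  qed simp
  have le: "Star q k \<le> ?m" "Tri q k \<le> ?m" if "k \<in> {1..4}" for k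
    using that by (auto simp: le_max_iff_disj)
  \<comment> \<open>The maximum is attained by some \<open>Star q k\<close> or
    \<open>Tri q i\<close>, and the corresponding family is the extremal one.\<close>
  have "?m \<in> Star q ` {1..4} \<or> ?m \<in> Tri q ` {1..4}"
    using Max_in[of "Star q ` {1..4}"] Max_in[of "Tri q ` {1..4}"] by (auto simp: max_def)
  then have "\<exists>F. intersecting {1..4} F \<and> sum (weight4 q) F = ?m"
  proof (elim disjE imageE)
    fix k assume "?m = Star q k" "k \<in> {1..4}"
    then show ?thesis using intersecting_star_family sum_star_family by metis
  next
    fix i assume "?m = Tri q i" "i \<in> {1..4}"
    then show ?thesis using intersecting_tri_family sum_tri_family by metis
  qed
  then obtain F where F: "intersecting {1..4} F" "sum weight F = ?m"
    using weight_eq by auto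
  show ?thesis
  proof (rule clique_number_eqI[OF _ F])
    fix F :: "nat set set" assume F: "intersecting {1..4} F"
    from sum_weight4_intersecting_le[OF F q] show "sum weight F \<le> ?m"
      unfolding weight_eq[OF F] using le by (meson order_trans)
  next
    \<comment> \<open>The summand 4 alone suffices here, whatever the orders of the fields.\<close>
    have "2 \<le> Tri q 1" by (simp add: Tri_def)
    also have "\<dots> \<le> ?m" by (rule le) simp
    finally show "2 \<le> ?m" .
  qed
qed

end
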